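(* Let $q$ be a prime power, let $m,n\ge 1$, and let $\mathcal{C}$ be an $[n,k,d]_{q^m/q}$ code. If $\mathcal{C}$ is rank-metric intersecting, then $\mathcal{C}$ is a $(2,1)$-separating rank-metric code.
   Context: Support and rank: fix an $\mathbb{F}_q$-basis $\Gamma$ of $\mathbb{F}_{q^m}$. For $x=(x_1,\dots,x_n)\in\mathbb{F}_{q^m}^n$ let $\mathrm{Mat}_\Gamma(x)\in\mathbb{F}_q^{m\times n}$ be the matrix whose $j$-th column is the coordinate vector of $x_j$ in the basis $\Gamma$. The support $\sigma(x)\subseteq\mathbb{F}_q^n$ is the $\mathbb{F}_q$-row space of $\mathrm{Mat}_\Gamma(x)$, and $\mathrm{rk}(x)=\dim_{\mathbb{F}_q}\sigma(x)$; both are independent of $\Gamma$. An $[n,k,d]_{q^m/q}$ code is an $\mathbb{F}_{q^m}$-linear subspace $\mathcal{C}$ of $\mathbb{F}_{q^m}^n$ with $k=\dim_{\mathbb{F}_{q^m}}\mathcal{C}\ge 1$ and minimum distance $d=\min_{c\in\mathcal{C}\setminus\{0\}}\mathrm{rk}(c)$. The code is rank-metric intersecting if $\sigma(c)\cap\sigma(c')\ne\{0\}$ for all $c,c'\in\mathcal{C}\setminus\{0\}$. A subset $\mathcal{C}\subseteq\mathbb{F}_{q^m}^n$ is a $(2,1)$-separating rank-metric code if all pairwise distinct $x,y,z\in\mathcal{C}$ satisfy $\mathrm{rk}(x-z)<\mathrm{rk}(x-y)+\mathrm{rk}(y-z)$. *)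

theory Defs
  imports "HOL-Analysis.Analysis"
begin

text \<open>
  The extension of finite fields is given by a pair of types \<open>'q\<close>, \<open>'e\<close> together with an
  embedding \<open>\<iota>\<close>. A basis of \<open>'e\<close> over \<open>'q\<close> is a family \<open>\<Gamma>\<close> indexed by \<open>'m\<close>, so a
  basis exists only if the extension has degree \<open>CARD('m)\<close>. The length of the codes is
  \<open>CARD('n)\<close>.
\<close>

definition field_embedding :: "('q::field \<Rightarrow> 'e::field) \<Rightarrow> bool" where
  "field_embedding \<iota> \<longleftrightarrow>
     \<iota> 1 = 1 \<and> (\<forall>a b. \<iota> (a + b) = \<iota> a + \<iota> b) \<and> (\<forall>a b. \<iota> (a * b) = \<iota> a * \<iota> b)"

definition ext_scale :: "('q::field \<Rightarrow> 'e::field) \<Rightarrow> 'q \<Rightarrow> 'e \<Rightarrow> 'e" where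
  "ext_scale \<iota> a x = \<iota> a * x"

definition is_ext_basis :: "('q::field \<Rightarrow> 'e::field) \<Rightarrow> ('m::finite \<Rightarrow> 'e) \<Rightarrow> bool" where
  "is_ext_basis \<iota> \<Gamma> \<longleftrightarrow>
     inj \<Gamma> \<and> \<not> module.dependent (ext_scale \<iota>) (range \<Gamma>) \<and>
     module.span (ext_scale \<iota>) (range \<Gamma>) = UNIV"

definition Mat ::
    "('q::field \<Rightarrow> 'e::field) \<Rightarrow> ('m::finite \<Rightarrow> 'e) \<Rightarrow> 'e ^ 'n::finite \<Rightarrow> 'q ^ 'n ^ 'm" where
  "Mat \<iota> \<Gamma> x = (\<chi> i j. module.representation (ext_scale \<iota>) (range \<Gamma>) (x $ j) (\<Gamma> i))"

definition supp ::
    "('q::field \<Rightarrow> 'e::field) \<Rightarrow> ('m::finite \<Rightarrow> 'e) \<Rightarrow> 'e ^ 'n::finite \<Rightarrow> ('q ^ 'n) set" where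
  "supp \<iota> \<Gamma> x = vec.span (rows (Mat \<iota> \<Gamma> x))"

definition rk ::
    "('q::field \<Rightarrow> 'e::field) \<Rightarrow> ('m::finite \<Rightarrow> 'e) \<Rightarrow> 'e ^ 'n::finite \<Rightarrow> nat" where
  "rk \<iota> \<Gamma> x = vec.dim (supp \<iota> \<Gamma> x)"

text \<open>The image below is finite because \<open>rk\<close> is bounded by \<open>CARD('n)\<close>, and it is nonempty
  because \<open>k \<ge> 1\<close>, so \<open>Min\<close> is a genuine minimum.\<close>

definition is_rank_metric_code ::
    "('q::field \<Rightarrow> 'e::field) \<Rightarrow> ('m::finite \<Rightarrow> 'e) \<Rightarrow> ('e ^ 'n::finite) set \<Rightarrow> nat \<Rightarrow> nat \<Rightarrow> bool" where
  "is_rank_metric_code \<iota> \<Gamma> C k d \<longleftrightarrow>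
     vec.subspace C \<and> vec.dim C = k \<and> k \<ge> 1 \<and> d = Min (rk \<iota> \<Gamma> ` (C - {0}))"

definition rank_metric_intersecting ::
    "('q::field \<Rightarrow> 'e::field) \<Rightarrow> ('m::finite \<Rightarrow> 'e) \<Rightarrow> ('e ^ 'n::finite) set \<Rightarrow> bool" where
  "rank_metric_intersecting \<iota> \<Gamma> C \<longleftrightarrow>
     (\<forall>c\<in>C - {0}. \<forall>c'\<in>C - {0}. supp \<iota> \<Gamma> c \<inter> supp \<iota> \<Gamma> c' \<noteq> {0})"

definition separating_2_1 ::
    "('q::field \<Rightarrow> 'e::field) \<Rightarrow> ('m::finite \<Rightarrow> 'e) \<Rightarrow> ('e ^ 'n::finite) set \<Rightarrow> bool" where
  "separating_2_1 \<iota> \<Gamma> C \<longleftrightarrow>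
     (\<forall>x\<in>C. \<forall>y\<in>C. \<forall>z\<in>C. x \<noteq> y \<and> y \<noteq> z \<and> x \<noteq> z \<longrightarrow>
        rk \<iota> \<Gamma> (x - z) < rk \<iota> \<Gamma> (x - y) + rk \<iota> \<Gamma> (y - z))"

end

theory Submission
  imports Defs
begin

text \<open>By linearity, x - y and y - z are nonzero codewords, and their sum is x - z. Taking
  coordinates in a basis is additive, so the support of a sum lies in the sum U + V of the two
  supports (\<open>supp_add_subset\<close>). Since dim (U + V) = dim U + dim V - dim (U \<inter> V),
  rank is subadditive, and strictly so when U and V meet nontrivially (\<open>rk_add_less\<close>),
  which is what the intersecting property provides.\<close>

lemma vector_space_ext_scale:
  assumes "field_embedding \<iota>"
  shows "vector_space (ext_scale \<iota>)"
  using assms by unfold_locales (auto simp: ext_scale_def field_embedding_def algebra_simps)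

lemma Mat_add:
  assumes "field_embedding \<iota>" and "is_ext_basis \<iota> \<Gamma>"
  shows "Mat \<iota> \<Gamma> (x + y) = Mat \<iota> \<Gamma> x + Mat \<iota> \<Gamma> y"
proof -
  interpret E: vector_space "ext_scale \<iota>"
    using assms(1) by (rule vector_space_ext_scale)
  \<comment> \<open>\<open>representation\<close> defaults to 0 on a dependent family or outside the
    span; a basis excludes both cases, so coordinates add.\<close>
  have "E.independent (range \<Gamma>)" and "E.span (range \<Gamma>) = UNIV"
    using assms(2) by (auto simp: is_ext_basis_def)
  then show ?thesis
    unfolding Mat_def vec_eq_iff by (simp add: E.representation_add)
qed

text \<open>Each generating row on the left is the sum of the two corresponding rows, and the
  right-hand side is a subspace, so it contains their whole span.\<close>

lemma supp_add_subset:
  assumes "field_embedding \<iota>" and "is_ext_basis \<iota> \<Gamma>"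
  shows "supp \<iota> \<Gamma> (x + y) \<subseteq> {u + v |u v. u \<in> supp \<iota> \<Gamma> x \<and> v \<in> supp \<iota> \<Gamma> y}"
  unfolding supp_def
proof (rule vec.span_minimal[OF subsetI])
  fix r
  assume "r \<in> rows (Mat \<iota> \<Gamma> (x + y))"
  then obtain i where "r = row i (Mat \<iota> \<Gamma> (x + y))"
    by (auto simp: rows_def)
  then have "r = row i (Mat \<iota> \<Gamma> x) + row i (Mat \<iota> \<Gamma> y)"
    by (simp add: Mat_add[OF assms] row_def vec_eq_iff)
  moreover have "row i (Mat \<iota> \<Gamma> x) \<in> vec.span (rows (Mat \<iota> \<Gamma> x))"
    and "row i (Mat \<iota> \<Gamma> y) \<in> vec.span (rows (Mat \<iota> \<Gamma> y))"
    by (auto simp: rows_def intro: vec.span_base)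
  ultimately show "r \<in> {u + v |u v. u \<in> vec.span (rows (Mat \<iota> \<Gamma> x)) \<and>
      v \<in> vec.span (rows (Mat \<iota> \<Gamma> y))}"
    by blast
qed (intro vec.subspace_sums vec.subspace_span)

lemma rk_add_less:
  assumes "field_embedding \<iota>" and "is_ext_basis \<iota> \<Gamma>"
    and "supp \<iota> \<Gamma> x \<inter> supp \<iota> \<Gamma> y \<noteq> {0}"
  shows "rk \<iota> \<Gamma> (x + y) < rk \<iota> \<Gamma> x + rk \<iota> \<Gamma> y"
proof -
  let ?U = "supp \<iota> \<Gamma> x" and ?V = "supp \<iota> \<Gamma> y"
  have sub: "vec.subspace ?U" "vec.subspace ?V"
    by (simp_all add: supp_def)
  then have "0 \<in> ?U \<inter> ?V"
    by (simp add: vec.subspace_0)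
  \<comment> \<open>An intersection that contains 0 but differs from {0} has a nonzero
    vector.\<close>
  with assms(3) have "vec.dim (?U \<inter> ?V) > 0"
    by auto
  moreover have "rk \<iota> \<Gamma> (x + y) \<le> vec.dim {u + v |u v. u \<in> ?U \<and> v \<in> ?V}"
    unfolding rk_def by (rule vec.dim_subset[OF supp_add_subset[OF assms(1,2)]])
  ultimately show ?thesis
    \<comment> \<open>The dimension formula turns the positive dimension of the intersection into
      strictness.\<close>
    using vec.dim_sums_Int[OF sub] by (simp add: rk_def)
qed

theorem theorem5p3:
  fixes \<iota> :: "'q::{field, finite} \<Rightarrow> 'e::{field, finite}"
    and \<Gamma> :: "'m::finite \<Rightarrow> 'e"
    and C :: "('e ^ 'n::finite) set"
    and k d :: nat
  assumes "field_embedding \<iota>"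
    and "is_ext_basis \<iota> \<Gamma>"
    and "is_rank_metric_code \<iota> \<Gamma> C k d"
    and "rank_metric_intersecting \<iota> \<Gamma> C"
  shows "separating_2_1 \<iota> \<Gamma> C"
  unfolding separating_2_1_def
proof (intro ballI impI)
  fix x y z
  assume xyz: "x \<in> C" "y \<in> C" "z \<in> C" "x \<noteq> y \<and> y \<noteq> z \<and> x \<noteq> z"
  have "vec.subspace C"
    using assms(3) by (simp add: is_rank_metric_code_def)
  with xyz have "x - y \<in> C - {0}" "y - z \<in> C - {0}"
    by (simp_all add: vec.subspace_diff)
  with assms(4) have "supp \<iota> \<Gamma> (x - y) \<inter> supp \<iota> \<Gamma> (y - z) \<noteq> {0}"
    unfolding rank_metric_intersecting_def by blast
  \<comment> \<open>The middle word cancels: (x - y) + (y - z) = x - z.\<close>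
  from rk_add_less[OF assms(1,2) this]
  show "rk \<iota> \<Gamma> (x - z) < rk \<iota> \<Gamma> (x - y) + rk \<iota> \<Gamma> (y - z)"
    by simp
qed

end
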